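(* Let $\alpha_0,\alpha_1\in\mathbb{C}$ with $\alpha_0+\alpha_1=0$. Consider the Hamiltonian system in two variables $t,s$ $$dq_i=\frac{\partial K_1}{\partial p_i}dt+\frac{\partial K_2}{\partial p_i}ds,\qquad dp_i=-\frac{\partial K_1}{\partial q_i}dt-\frac{\partial K_2}{\partial q_i}ds\qquad(i=1,2)$$ with $$\begin{aligned} K_1&=q_1^2p_1+\alpha_0q_1-\tfrac{q_2^2}{2}-p_2^3-\tfrac{3}{20}p_2+p_1p_2,\\ K_2&=\tfrac{p_1^2}{2}-\tfrac{3}{20}p_1-\alpha_1q_2-p_1p_2^2+2q_1^2p_1p_2+2q_1p_1q_2+2\alpha_0q_1p_2. \end{aligned}$$ Then the birational transformations $$x=-q_1,\quad y=-(p_2+q_1^2),\quad z=-(q_2+2q_1p_2+2q_1^3),\quad w=-\Big(p_1+2q_1q_2-p_2^2+8q_1^2p_2+6q_1^4-\tfrac{3}{20}\Big)$$ take this Hamiltonian system to the system $$\begin{aligned} dx={}&y\,dt+(w-6x^2y)\,ds,\\ dy={}&z\,dt+\Big(4x^2z-2xy^2-6x^5-\tfrac{3}{10}x+\alpha_0\Big)ds,\\ dz={}&w\,dt+\Big(-30x^4y-2y^3+4xyz+4x^2w-\tfrac{3}{10}y\Big)ds,\\ dw={}&\Big(10xy^2+10x^2z-6x^5-\tfrac{3}{10}x+\alpha_0\Big)dt\\ &+\Big(-24x^7+10x^4z-80x^3y^2+12xyw-2y^2z+4xz^2-\tfrac65x^3+4\alpha_0x^2-\tfrac{3}{10}z\Big)ds.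 \end{aligned}$$ *)

theory Defs
  imports "HOL-Analysis.Analysis"
begin

inductive polynomial_fun :: "(complex^'n \<Rightarrow> complex) \<Rightarrow> bool" where
  const: "polynomial_fun (\<lambda>v. c)"
| coord: "polynomial_fun (\<lambda>v. v $ i)"
| add: "polynomial_fun f \<Longrightarrow> polynomial_fun g \<Longrightarrow> polynomial_fun (\<lambda>v. f v + g v)"
| mult: "polynomial_fun f \<Longrightarrow> polynomial_fun g \<Longrightarrow> polynomial_fun (\<lambda>v. f v * g v)"

definition zariski_open :: "(complex^'n) set \<Rightarrow> bool" where
  "zariski_open U \<longleftrightarrow>
     (\<exists>F. (\<forall>f\<in>F. polynomial_fun f) \<and> U = {v. \<exists>f\<in>F. f v \<noteq> 0})"

text \<open>A single global quotient suffices for regularity on a Zariski open subset of affine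
  space, because polynomial rings over a field are factorial.\<close>

definition regular_map_on :: "(complex^'n) set \<Rightarrow> (complex^'n \<Rightarrow> complex^'m) \<Rightarrow> bool" where
  "regular_map_on U \<phi> \<longleftrightarrow>
     (\<forall>i. \<exists>f g. polynomial_fun f \<and> polynomial_fun g \<and>
        (\<forall>v\<in>U. g v \<noteq> 0 \<and> \<phi> v $ i = f v / g v))"

text \<open>A total function represents a birational map if it restricts to an isomorphism between
  nonempty Zariski open subsets; its values off the first subset are irrelevant.\<close>

definition birational_map :: "(complex^'n \<Rightarrow> complex^'n) \<Rightarrow> bool" where
  "birational_map \<phi> \<longleftrightarrow>
     (\<exists>U V \<psi>. zariski_open U \<and> U \<noteq> {} \<and> zariski_open V \<and> V \<noteq> {} \<and>
        regular_map_on U \<phi> \<and> regular_map_on V \<psi> \<and>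
        (\<forall>v\<in>U. \<phi> v \<in> V \<and> \<psi> (\<phi> v) = v) \<and>
        (\<forall>v\<in>V. \<psi> v \<in> U \<and> \<phi> (\<psi> v) = v))"

text \<open>The system \<open>du = A(u) dt + B(u) ds\<close> on an open set of pairs \<open>(t, s)\<close>, as an equality of
  total differentials: \<open>h\<close> and \<open>k\<close> are the values of \<open>dt\<close> and \<open>ds\<close> on a tangent vector.
  The derivative is complex linear, so solutions are holomorphic.\<close>

definition pfaff_solution ::
  "(complex^'n \<Rightarrow> complex^'n) \<Rightarrow> (complex^'n \<Rightarrow> complex^'n) \<Rightarrow>
   (complex \<times> complex) set \<Rightarrow> (complex \<times> complex \<Rightarrow> complex^'n) \<Rightarrow> bool" where
  "pfaff_solution A B D u \<longleftrightarrow>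
     open D \<and>
     (\<forall>\<tau>\<in>D. (u has_derivative (\<lambda>(h, k). h *s A (u \<tau>) + k *s B (u \<tau>))) (at \<tau>))"

definition pushes_forward ::
  "(complex^'n \<Rightarrow> complex^'n) \<Rightarrow> (complex^'n \<Rightarrow> complex^'n) \<Rightarrow> (complex^'n \<Rightarrow> complex^'n) \<Rightarrow> bool" where
  "pushes_forward \<phi> A A' \<longleftrightarrow>
     (\<forall>v. \<exists>L. (\<phi> has_derivative L) (at v) \<and> L (A v) = A' (\<phi> v))"

text \<open>Substituting \<open>\<phi>\<close> turns the system with coefficients \<open>A, B\<close> into the one with coefficients
  \<open>A', B'\<close>, both for the coefficient vector fields and for solutions.\<close>

definition takes_system_to ::
  "(complex^'n \<Rightarrow> complex^'n) \<Rightarrow>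
   (complex^'n \<Rightarrow> complex^'n) \<Rightarrow> (complex^'n \<Rightarrow> complex^'n) \<Rightarrow>
   (complex^'n \<Rightarrow> complex^'n) \<Rightarrow> (complex^'n \<Rightarrow> complex^'n) \<Rightarrow> bool" where
  "takes_system_to \<phi> A B A' B' \<longleftrightarrow>
     pushes_forward \<phi> A A' \<and> pushes_forward \<phi> B B' \<and>
     (\<forall>D u. pfaff_solution A B D u \<longleftrightarrow> pfaff_solution A' B' D (\<lambda>\<tau>. \<phi> (u \<tau>)))"

definition partial_deriv :: "'n \<Rightarrow> (complex^'n \<Rightarrow> complex) \<Rightarrow> complex^'n \<Rightarrow> complex" where
  "partial_deriv i K v = deriv (\<lambda>\<xi>. K (\<chi> j. if j = i then \<xi> else v $ j)) (v $ i)"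

text \<open>Phase space coordinates are ordered \<open>(q\<^sub>1, q\<^sub>2, p\<^sub>1, p\<^sub>2)\<close>.\<close>

definition hamiltonian_field :: "(complex^4 \<Rightarrow> complex) \<Rightarrow> complex^4 \<Rightarrow> complex^4" where
  "hamiltonian_field K v =
     vector [partial_deriv 3 K v, partial_deriv 4 K v,
             - partial_deriv 1 K v, - partial_deriv 2 K v]"

definition K1 :: "complex \<Rightarrow> complex^4 \<Rightarrow> complex" where
  "K1 \<alpha>0 v = (let q1 = v $ 1; q2 = v $ 2; p1 = v $ 3; p2 = v $ 4 in
     q1^2 * p1 + \<alpha>0 * q1 - q2^2 / 2 - p2^3 - 3/20 * p2 + p1 * p2)"

definition K2 :: "complex \<Rightarrow> complex \<Rightarrow> complex^4 \<Rightarrow> complex" where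
  "K2 \<alpha>0 \<alpha>1 v = (let q1 = v $ 1; q2 = v $ 2; p1 = v $ 3; p2 = v $ 4 in
     p1^2 / 2 - 3/20 * p1 - \<alpha>1 * q2 - p1 * p2^2 + 2 * q1^2 * p1 * p2
     + 2 * q1 * p1 * q2 + 2 * \<alpha>0 * q1 * p2)"

definition transf :: "complex^4 \<Rightarrow> complex^4" where
  "transf v = (let q1 = v $ 1; q2 = v $ 2; p1 = v $ 3; p2 = v $ 4 in
     vector
      [- q1,
       - (p2 + q1^2),
       - (q2 + 2 * q1 * p2 + 2 * q1^3),
       - (p1 + 2 * q1 * q2 - p2^2 + 8 * q1^2 * p2 + 6 * q1^4 - 3/20)])"

definition target_t :: "complex \<Rightarrow> complex^4 \<Rightarrow> complex^4" where
  "target_t \<alpha>0 v = (let x = v $ 1; y = v $ 2; z = v $ 3; w = v $ 4 in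
     vector
      [y,
       z,
       w,
       10 * x * y^2 + 10 * x^2 * z - 6 * x^5 - 3/10 * x + \<alpha>0])"

definition target_s :: "complex \<Rightarrow> complex^4 \<Rightarrow> complex^4" where
  "target_s \<alpha>0 v = (let x = v $ 1; y = v $ 2; z = v $ 3; w = v $ 4 in
     vector
      [w - 6 * x^2 * y,
       4 * x^2 * z - 2 * x * y^2 - 6 * x^5 - 3/10 * x + \<alpha>0,
       - 30 * x^4 * y - 2 * y^3 + 4 * x * y * z + 4 * x^2 * w - 3/10 * y,
       - 24 * x^7 + 10 * x^4 * z - 80 * x^3 * y^2 + 12 * x * y * w - 2 * y^2 * z
         + 4 * x * z^2 - 6/5 * x^3 + 4 * \<alpha>0 * x^2 - 3/10 * z])"

end

theory Submission
  imports Defs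
begin

text \<open>The transformation is a polynomial automorphism of affine four-space: its components can be
  solved in turn for \<open>q\<^sub>1\<close>, \<open>p\<^sub>2\<close>, \<open>q\<^sub>2\<close>, \<open>p\<^sub>1\<close>. Hence it is birational, and
  the chain rule, applied to it and to its inverse, reduces the equivalence of the two systems to
  the polynomial identity saying that its Jacobian carries each Hamiltonian vector field to the
  corresponding target field.\<close>

lemma polynomial_fun_uminus: "polynomial_fun f \<Longrightarrow> polynomial_fun (\<lambda>v. - f v)"
  using polynomial_fun.mult[OF polynomial_fun.const[of "-1"]] by fastforce

lemma polynomial_fun_diff:
  "polynomial_fun f \<Longrightarrow> polynomial_fun g \<Longrightarrow> polynomial_fun (\<lambda>v. f v - g v)"
  using polynomial_fun.add[OF _ polynomial_fun_uminus, of f g] by simp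

lemma polynomial_fun_power: "polynomial_fun f \<Longrightarrow> polynomial_fun (\<lambda>v. f v ^ n)"
  by (induction n) (auto intro: polynomial_fun.intros)

lemmas polynomial_fun_intros =
  polynomial_fun.intros polynomial_fun_uminus polynomial_fun_diff polynomial_fun_power

lemma regular_map_on_polynomial:
  assumes "\<And>i. polynomial_fun (\<lambda>v. \<phi> v $ i)"
  shows "regular_map_on U \<phi>"
  unfolding regular_map_on_def
proof
  fix i
  show "\<exists>f g. polynomial_fun f \<and> polynomial_fun g \<and> (\<forall>v\<in>U. g v \<noteq> 0 \<and> \<phi> v $ i = f v / g v)"
    using assms[of i] polynomial_fun.const[of 1]
    by (intro exI[of _ "\<lambda>v. \<phi> v $ i"] exI[of _ "\<lambda>v. 1"]) simp
qed

lemma zariski_open_UNIV: "zariski_open UNIV"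
  unfolding zariski_open_def
  by (intro exI[of _ "{\<lambda>v. 1}"]) (auto intro: polynomial_fun.const)

text \<open>When both maps are polynomial, the sets \<open>U\<close> and \<open>V\<close> in the
  definition can be the whole space, with every denominator equal to 1.\<close>

lemma birational_map_polynomial_automorphism:
  assumes "\<And>i. polynomial_fun (\<lambda>v. \<phi> v $ i)" "\<And>i. polynomial_fun (\<lambda>v. \<psi> v $ i)"
    and "\<And>v. \<psi> (\<phi> v) = v" "\<And>v. \<phi> (\<psi> v) = v"
  shows "birational_map \<phi>"
  unfolding birational_map_def
  using assms
  by (intro exI[of _ UNIV] exI[of _ \<psi>])
    (auto intro: regular_map_on_polynomial zariski_open_UNIV)

text \<open>\<open>f\<close> is the finite sum of its components composed with the bounded linear
  injections \<open>axis i\<close>, so derivatives may be found coordinate by coordinate.\<close>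

lemma has_derivative_vecI:
  fixes f :: "'a::real_normed_vector \<Rightarrow> 'b::real_normed_vector ^ 'n"
  assumes "\<And>i. ((\<lambda>v. f v $ i) has_derivative (\<lambda>x. f' x $ i)) (at a within S)"
  shows "(f has_derivative f') (at a within S)"
proof -
  have axis: "bounded_linear (axis i :: 'b \<Rightarrow> 'b ^ 'n)" for i
  \<comment> \<open>The bound is 1 because the L2 sum of \<open>axis i x\<close> has a single
    possibly nonzero term, the square of \<open>norm x\<close>.\<close>
  proof (rule bounded_linear_intro[where K = 1])
    show "norm (axis i x :: 'b ^ 'n) \<le> norm x * 1" for x :: 'b
      by (simp add: norm_vec_def L2_set_def axis_def if_distrib[of norm] if_distrib[of "\<lambda>x. x\<^sup>2"]
          cong: if_cong)
  qed (simp_all add: axis_def vec_eq_iff)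
  have expand: "w = (\<Sum>i\<in>UNIV. axis i (w $ i))" for w :: "'b ^ 'n"
    by (simp add: vec_eq_iff axis_def)
  have "((\<lambda>v. \<Sum>i\<in>UNIV. axis i (f v $ i)) has_derivative (\<lambda>x. \<Sum>i\<in>UNIV. axis i (f' x $ i)))
      (at a within S)"
    by (intro has_derivative_sum bounded_linear.has_derivative[OF axis] assms)
  then show ?thesis
    by (simp flip: expand)
qed

lemma polynomial_fun_differentiable: "polynomial_fun f \<Longrightarrow> f differentiable at v"
  by (induction rule: polynomial_fun.induct)
    (auto intro: bounded_linear_imp_differentiable bounded_linear_vec_nth)

text \<open>Serves the inverse transformation, whose Jacobian is never written out.\<close>

lemma polynomial_map_differentiable:
  assumes "\<And>i. polynomial_fun (\<lambda>v. \<phi> v $ i)"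
  shows "\<phi> differentiable at v"
proof -
  have "((\<lambda>v. \<phi> v $ i) has_derivative frechet_derivative (\<lambda>v. \<phi> v $ i) (at v)) (at v)" for i
    using polynomial_fun_differentiable[OF assms] by (simp add: frechet_derivative_works)
  then have "(\<phi> has_derivative (\<lambda>x. \<chi> i. frechet_derivative (\<lambda>v. \<phi> v $ i) (at v) x)) (at v)"
    by (intro has_derivative_vecI) simp
  then show ?thesis
    by (rule differentiableI)
qed

text \<open>The chain rule with \<phi> carries solutions forward, and with \<psi> it carries them
  back. Complex homogeneity is the separate hypothesis \<open>scale\<close> because
  \<open>has_derivative\<close> yields only real linearity, while the increments \<open>h\<close>
  and \<open>k\<close> are complex.\<close>

lemma takes_system_to_diffeomorphism:
  assumes \<phi>: "\<And>v. (\<phi> has_derivative \<phi>' v) (at v)"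
    and \<psi>: "\<And>v. (\<psi> has_derivative \<psi>' v) (at v)"
    and inv: "\<And>v. \<psi> (\<phi> v) = v"
    and scale: "\<And>v c x. \<phi>' v (c *s x) = c *s \<phi>' v x"
    and A: "\<And>v. \<phi>' v (A v) = A' (\<phi> v)"
    and B: "\<And>v. \<phi>' v (B v) = B' (\<phi> v)"
  shows "takes_system_to \<phi> A B A' B'"
proof -
  have add: "\<phi>' v (x + y) = \<phi>' v x + \<phi>' v y" for v x y
    using has_derivative_linear[OF \<phi>] by (rule linear_add)
  have push: "\<phi>' v (h *s A v + k *s B v) = h *s A' (\<phi> v) + k *s B' (\<phi> v)" for v h k
    by (simp add: add scale A B)
  \<comment> \<open>Differentiating \<open>\<psi> (\<phi> v) = v\<close> shows that
    \<open>\<psi>' (\<phi> v)\<close> is a left inverse of \<open>\<phi>' v\<close>, so it undoes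
    \<open>push\<close>.\<close>
  have pull: "\<psi>' (\<phi> v) (h *s A' (\<phi> v) + k *s B' (\<phi> v)) = h *s A v + k *s B v" for v h k
  proof -
    have "((\<lambda>v. \<psi> (\<phi> v)) has_derivative (\<lambda>x. \<psi>' (\<phi> v) (\<phi>' v x))) (at v)"
      using \<phi> \<psi> by (rule has_derivative_compose)
    then have "(\<lambda>x. \<psi>' (\<phi> v) (\<phi>' v x)) = (\<lambda>x. x)"
      using has_derivative_unique[OF _ has_derivative_ident] by (simp add: inv)
    then have "\<psi>' (\<phi> v) (\<phi>' v (h *s A v + k *s B v)) = h *s A v + k *s B v"
      by (rule fun_cong)
    then show ?thesis
      by (simp add: push)
  qed
  have "pfaff_solution A' B' D (\<lambda>\<tau>. \<phi> (u \<tau>))" if "pfaff_solution A B D u" for D u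
    using that has_derivative_compose[OF _ \<phi>]
    unfolding pfaff_solution_def by (fastforce simp: push case_prod_unfold)
  \<comment> \<open>Here \<open>u\<close> itself is not known to be differentiable; it is recovered
    by composing \<psi> with the given solution.\<close>
  moreover have "pfaff_solution A B D u" if "pfaff_solution A' B' D (\<lambda>\<tau>. \<phi> (u \<tau>))" for D u
    using that has_derivative_compose[OF _ \<psi>, of "\<lambda>\<tau>. \<phi> (u \<tau>)"]
    unfolding pfaff_solution_def by (fastforce simp: pull inv case_prod_unfold)
  ultimately show ?thesis
    unfolding takes_system_to_def pushes_forward_def
    using \<phi> A B by blast
qed

lemma vector_4_nth:
  "(vector [a, b, c, d] :: 'a::zero ^ 4) $ 1 = a"
  "(vector [a, b, c, d] :: 'a ^ 4) $ 2 = b"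
  "(vector [a, b, c, d] :: 'a ^ 4) $ 3 = c"
  "(vector [a, b, c, d] :: 'a ^ 4) $ 4 = d"
  by (simp_all add: vector_def)

text \<open>Obtained by back-substitution from \<open>q1 = - x\<close> and
  \<open>p2 = - y - x^2\<close>; the cubic terms in \<open>x\<close> cancel in the second
  entry.\<close>

definition transf_inv :: "complex^4 \<Rightarrow> complex^4" where
  "transf_inv v = (let x = v $ 1; y = v $ 2; z = v $ 3; w = v $ 4 in
     vector
      [- x,
       - z - 2 * x * y,
       - w - 2 * x * z + 6 * x^2 * y + y^2 + 3 * x^4 + 3/20,
       - y - x^2])"

text \<open>The Jacobian matrix of \<open>transf\<close> at \<open>v\<close> applied to the tangent
  vector \<open>h\<close>, kept explicit so that its action on the Hamiltonian fields can be
  computed.\<close>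

definition transf_deriv :: "complex^4 \<Rightarrow> complex^4 \<Rightarrow> complex^4" where
  "transf_deriv v h = (let q1 = v $ 1; q2 = v $ 2; p1 = v $ 3; p2 = v $ 4;
       h1 = h $ 1; h2 = h $ 2; h3 = h $ 3; h4 = h $ 4 in
     vector
      [- h1,
       - (h4 + 2 * q1 * h1),
       - (h2 + 2 * p2 * h1 + 2 * q1 * h4 + 6 * q1^2 * h1),
       - (h3 + 2 * q2 * h1 + 2 * q1 * h2 - 2 * p2 * h4 + 16 * q1 * p2 * h1 + 8 * q1^2 * h4
          + 24 * q1^3 * h1)])"

lemmas vec4_simps = Let_def vector_4_nth forall_4

lemma transf_inv_transf: "transf_inv (transf v) = v"
  by (simp add: transf_inv_def transf_def vec_eq_iff vec4_simps) algebra

lemma transf_transf_inv: "transf (transf_inv v) = v"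
  by (simp add: transf_inv_def transf_def vec_eq_iff vec4_simps) algebra

lemma polynomial_fun_transf: "polynomial_fun (\<lambda>v. transf v $ i)"
proof -
  \<comment> \<open>The quantifier over \<open>i\<close> is explicit so that \<open>forall_4\<close>
    can split it into the four coordinates.\<close>
  have "\<forall>i. polynomial_fun (\<lambda>v. transf v $ i)"
    unfolding transf_def vec4_simps by (intro conjI polynomial_fun_intros)
  then show ?thesis ..
qed

lemma polynomial_fun_transf_inv: "polynomial_fun (\<lambda>v. transf_inv v $ i)"
proof -
  have "\<forall>i. polynomial_fun (\<lambda>v. transf_inv v $ i)"
    unfolding transf_inv_def vec4_simps by (intro conjI polynomial_fun_intros)
  then show ?thesis ..
qed

lemma has_derivative_transf: "(transf has_derivative transf_deriv v) (at v)"
proof (rule has_derivative_vecI)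
  note [derivative_intros] = bounded_linear.has_derivative[OF bounded_linear_vec_nth]
  have "\<forall>i. ((\<lambda>v. transf v $ i) has_derivative (\<lambda>h. transf_deriv v h $ i)) (at v)"
    unfolding transf_def transf_deriv_def vec4_simps
    \<comment> \<open>Writing numerals as successors resolves the factors \<open>of_nat n\<close>
      and exponents \<open>n - 1\<close> left by the power rule.\<close>
    by (intro conjI; (rule derivative_eq_intros refl)+; simp add: algebra_simps power2_eq_square power3_eq_cube numeral_eq_Suc)
  then show "((\<lambda>v. transf v $ i) has_derivative (\<lambda>h. transf_deriv v h $ i)) (at v)" for i ..
qed

lemma transf_deriv_scale: "transf_deriv v (c *s x) = c *s transf_deriv v x"
  by (simp add: transf_deriv_def vec_eq_iff vec4_simps algebra_simps)

text \<open>Each entry is a \<open>deriv\<close> of a one-variable slice of the Hamiltonian, so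
  exhibiting a derivative of that slice determines it.\<close>

lemma hamiltonian_field_K1:
  "hamiltonian_field (K1 \<alpha>0) v = (let q1 = v $ 1; q2 = v $ 2; p1 = v $ 3; p2 = v $ 4 in
     vector [q1^2 + p2, - 3 * p2^2 - 3/20 + p1, - 2 * q1 * p1 - \<alpha>0, q2])"
proof -
  have "partial_deriv 3 (K1 \<alpha>0) v = (v$1)^2 + v$4"
    unfolding partial_deriv_def K1_def Let_def
    by (rule DERIV_imp_deriv) (auto intro!: derivative_eq_intros)
  moreover have "partial_deriv 4 (K1 \<alpha>0) v = - 3 * (v$4)^2 - 3/20 + v$3"
    unfolding partial_deriv_def K1_def Let_def
    by (rule DERIV_imp_deriv) (auto intro!: derivative_eq_intros)
  moreover have "partial_deriv 1 (K1 \<alpha>0) v = 2 * v$1 * v$3 + \<alpha>0"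
    unfolding partial_deriv_def K1_def Let_def
    by (rule DERIV_imp_deriv) (auto intro!: derivative_eq_intros)
  moreover have "partial_deriv 2 (K1 \<alpha>0) v = - (v$2)"
    unfolding partial_deriv_def K1_def Let_def
    by (rule DERIV_imp_deriv) (auto intro!: derivative_eq_intros)
  ultimately show ?thesis
    by (simp add: hamiltonian_field_def Let_def)
qed

lemma hamiltonian_field_K2:
  "hamiltonian_field (K2 \<alpha>0 \<alpha>1) v = (let q1 = v $ 1; q2 = v $ 2; p1 = v $ 3; p2 = v $ 4 in
     vector
      [p1 - 3/20 - p2^2 + 2 * q1^2 * p2 + 2 * q1 * q2,
       - 2 * p1 * p2 + 2 * q1^2 * p1 + 2 * \<alpha>0 * q1,
       - 4 * q1 * p1 * p2 - 2 * p1 * q2 - 2 * \<alpha>0 * p2,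
       \<alpha>1 - 2 * q1 * p1])"
proof -
  have "partial_deriv 3 (K2 \<alpha>0 \<alpha>1) v = v$3 - 3/20 - (v$4)^2 + 2 * (v$1)^2 * v$4 + 2 * v$1 * v$2"
    unfolding partial_deriv_def K2_def Let_def
    by (rule DERIV_imp_deriv) (auto intro!: derivative_eq_intros)
  moreover have "partial_deriv 4 (K2 \<alpha>0 \<alpha>1) v = - 2 * v$3 * v$4 + 2 * (v$1)^2 * v$3 + 2 * \<alpha>0 * v$1"
    unfolding partial_deriv_def K2_def Let_def
    by (rule DERIV_imp_deriv) (auto intro!: derivative_eq_intros)
  moreover have "partial_deriv 1 (K2 \<alpha>0 \<alpha>1) v = 4 * v$1 * v$3 * v$4 + 2 * v$3 * v$2 + 2 * \<alpha>0 * v$4"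
    unfolding partial_deriv_def K2_def Let_def
    by (rule DERIV_imp_deriv) (auto intro!: derivative_eq_intros)
  moreover have "partial_deriv 2 (K2 \<alpha>0 \<alpha>1) v = - \<alpha>1 + 2 * v$1 * v$3"
    unfolding partial_deriv_def K2_def Let_def
    by (rule DERIV_imp_deriv) (auto intro!: derivative_eq_intros)
  ultimately show ?thesis
    by (simp add: hamiltonian_field_def Let_def)
qed

text \<open>In the coordinates of \<open>v\<close> each component becomes a polynomial identity,
  with \<alpha>0 entering only in the last one.\<close>

lemma transf_deriv_K1:
  "transf_deriv v (hamiltonian_field (K1 \<alpha>0) v) = target_t \<alpha>0 (transf v)"
  unfolding hamiltonian_field_K1 transf_deriv_def transf_def target_t_def vec_eq_iff vec4_simps
  by (intro conjI; simp add: field_simps; algebra)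

text \<open>The relation between the parameters is visible in the second component: its constant
  term is \<open>- \<alpha>1\<close> on the left and \<alpha>0 on the right. In the third, it makes
  the parameter terms cancel.\<close>

lemma transf_deriv_K2:
  assumes "\<alpha>0 + \<alpha>1 = 0"
  shows "transf_deriv v (hamiltonian_field (K2 \<alpha>0 \<alpha>1) v) = target_s \<alpha>0 (transf v)"
proof -
  have \<alpha>1: "\<alpha>1 = - \<alpha>0"
    using assms by (simp add: eq_neg_iff_add_eq_0 add.commute)
  show ?thesis
    unfolding hamiltonian_field_K2 transf_deriv_def transf_def target_s_def vec_eq_iff vec4_simps \<alpha>1
    by (intro conjI; simp add: field_simps; algebra)
qed

theorem theorem5p7:
  fixes \<alpha>0 \<alpha>1 :: complex
  assumes "\<alpha>0 + \<alpha>1 = 0"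
  shows "birational_map transf \<and>
    takes_system_to transf
      (hamiltonian_field (K1 \<alpha>0)) (hamiltonian_field (K2 \<alpha>0 \<alpha>1))
      (target_t \<alpha>0) (target_s \<alpha>0)"
proof
  show "birational_map transf"
    using polynomial_fun_transf polynomial_fun_transf_inv transf_inv_transf transf_transf_inv
    by (rule birational_map_polynomial_automorphism)
  have "transf_inv differentiable at v" for v
    using polynomial_fun_transf_inv by (rule polynomial_map_differentiable)
  \<comment> \<open>Any derivative of the inverse suffices, since its action on the target fields is
    forced by the chain rule.\<close>
  then have "(transf_inv has_derivative frechet_derivative transf_inv (at v)) (at v)" for v
    by (simp add: frechet_derivative_works)
  then show "takes_system_to transf
      (hamiltonian_field (K1 \<alpha>0)) (hamiltonian_field (K2 \<alpha>0 \<alpha>1)) (target_t \<alpha>0) (target_s \<alpha>0)"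
    using has_derivative_transf transf_inv_transf transf_deriv_scale transf_deriv_K1
      transf_deriv_K2[OF assms]
    by (intro takes_system_to_diffeomorphism)
qed

end
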